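(* Let $k\ge 2$ and $n\ge 1$ be integers, $N=kn$, and let $\varphi$ be a shuffling weight function for $N$ and $k$, with its associated shuffling poset. A stack $a_0,\ldots,a_{N-1}$ with labels from a finite totally ordered set is fixed under the shuffling if and only if both of the following hold: (i) whenever $x$ and $y$ are subscripts joined by an edge between levels in the shuffling poset and $\varphi(x)<\varphi(y)$, then $a_x\succeq a_y$; (ii) all the labels in a cycle of the shuffling poset agree, i.e. $a_x=a_y$ whenever $x$ and $y$ are subscripts in the same cycle.
   Context: A stack of $N=kn$ cards is a sequence $a_0,a_1,\ldots,a_{N-1}$ of labels from a finite totally ordered set $\mathcal{A}_1\succ\mathcal{A}_2\succ\cdots\succ\mathcal{A}_j$ (labels may be repeated). The shuffling sends it to the stack $b_0,\ldots,b_{N-1}$ where, for each $\ell\in\{0,1,\ldots,n-1\}$, the labels $b_{k\ell},b_{k\ell+1},\ldots,b_{k\ell+(k-1)}$ are the labels $a_\ell,a_{\ell+n},\ldots,a_{\ell+(k-1)n}$ (with multiplicity) sorted so that $b_{k\ell}\succeq b_{k\ell+1}\succeq\cdots\succeq b_{k\ell+(k-1)}$. A stack is fixed if one shuffle returns it to itself. For $\ell\in\{0,\ldots,n-1\}$ the $\ell$-th column is the set of subscripts $\{\ell,\ell+n,\ldots,\ell+(k-1)n\}$ and the $\ell$-th block is $\{k\ell,k\ell+1,\ldots,k\ell+(k-1)\}$. A shuffling weight function is a map $\varphi:\{0,\ldots,N-1\}\to\mathbb{Z}$ such that for all $\ell\in\{0,1,\ldots,n-1\}$: (i) $\{\varphi(\ell),\varphi(\ell+n),\ldots,\varphi(\ell+(k-1)n)\}=\{\varphi(k\ell),\varphi(k\ell+1),\ldots,\varphi(k\ell+(k-1))\}$;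 and (ii) $\varphi(k\ell)<\varphi(k\ell+1)<\cdots<\varphi(k\ell+(k-1))$. (In particular $\varphi$ is injective on each column and on each block.) The shuffling poset of $\varphi$: let $\pi$ be the permutation of $\{0,\ldots,N-1\}$ sending each subscript $x$ of the $\ell$-th column to the unique subscript $\pi(x)$ of the $\ell$-th block with $\varphi(\pi(x))=\varphi(x)$. The cycles of the shuffling poset are the cycles of $\pi$, each placed at the level (height) equal to the common $\varphi$-value of its subscripts. The edges between levels join any two distinct subscripts that lie in the same column. *)

theory Defs
  imports Main "HOL-Combinatorics.Orbits"
begin

(* A stack a_0, ..., a_(N-1) is a list of length N = k * n; the order \<succ> on labels is > of the
   linear order class. *)

definition column :: "nat \<Rightarrow> nat \<Rightarrow> nat \<Rightarrow> nat set" where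
  "column k n l = (\<lambda>i. l + i * n) ` {..<k}"

definition block :: "nat \<Rightarrow> nat \<Rightarrow> nat set" where
  "block k l = {k * l..<k * l + k}"

definition shuffle_stack :: "nat \<Rightarrow> nat \<Rightarrow> 'a::linorder list \<Rightarrow> 'a list" where
  "shuffle_stack k n a =
     concat (map (\<lambda>l. rev (sort (map (\<lambda>i. a ! (l + i * n)) [0..<k]))) [0..<n])"

definition fixed_stack :: "nat \<Rightarrow> nat \<Rightarrow> 'a::linorder list \<Rightarrow> bool" where
  "fixed_stack k n a \<longleftrightarrow> shuffle_stack k n a = a"

(* Only the values of \<phi> on {..<k * n} are constrained or used. *)
definition shuffling_weight :: "nat \<Rightarrow> nat \<Rightarrow> (nat \<Rightarrow> int) \<Rightarrow> bool" where
  "shuffling_weight k n \<phi> \<longleftrightarrow>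
     (\<forall>l<n. \<phi> ` column k n l = \<phi> ` block k l \<and> strict_mono_on (block k l) \<phi>)"

(* The permutation \<pi>, extended by the identity outside {..<k * n}. For a shuffling weight function
   the description is unique: x < k * n lies in exactly one column, and \<phi> is injective on the
   corresponding block. *)
definition poset_perm :: "nat \<Rightarrow> nat \<Rightarrow> (nat \<Rightarrow> int) \<Rightarrow> nat \<Rightarrow> nat" where
  "poset_perm k n \<phi> x =
     (if x < k * n
      then THE y. \<exists>l<n. x \<in> column k n l \<and> y \<in> block k l \<and> \<phi> y = \<phi> x
      else x)"

definition poset_cycles :: "nat \<Rightarrow> nat \<Rightarrow> (nat \<Rightarrow> int) \<Rightarrow> nat set set" where
  "poset_cycles k n \<phi> = orbit (poset_perm k n \<phi>) ` {..<k * n}"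

(* Subscripts joined by an edge between levels. The level of a cycle is the common \<phi>-value of its
   members, so the level of (the cycle of) a subscript x is \<phi> x. *)
definition poset_edge :: "nat \<Rightarrow> nat \<Rightarrow> nat \<Rightarrow> nat \<Rightarrow> bool" where
  "poset_edge k n x y \<longleftrightarrow> x \<noteq> y \<and> (\<exists>l<n. x \<in> column k n l \<and> y \<in> column k n l)"

end

theory Submission
  imports Defs "HOL-Library.Multiset"
begin

text \<open>
  Both conditions of the theorem reduce to statements about one block at a time. A stack is fixed iff
  on every block the labels are weakly decreasing and form the same multiset as the labels on the
  column with the same index. The permutation \<open>\<pi>\<close> maps each column bijectively onto the block
  with the same index and preserves \<open>\<phi>\<close>, and on a block \<open>\<phi>\<close> increases with the subscript.
  So once the labels are invariant under \<open>\<pi>\<close>, the multiset condition is automatic, and condition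
  (i) on a column is the same as monotonicity on the block. Condition (ii) says exactly that the
  labels are invariant under \<open>\<pi>\<close>. What remains is that a fixed stack has \<open>\<pi>\<close>-invariant labels.

  For this, fix a threshold \<open>c\<close> and let \<open>S\<close> be the set of subscripts with label at least \<open>c\<close>.
  In a fixed stack \<open>S\<close> meets a column and the corresponding block in equally many subscripts, and
  within the block these are the ones of least weight. As column and block carry the same weights,
  the weights in \<open>S\<close> have at least as large a sum over the column as over the block, with equality
  only if \<open>\<pi>\<close> carries the column part of \<open>S\<close> onto the block part. But the columns and the blocks
  both partition the subscripts, so the two sums agree in total, hence for every single column.
  Thus \<open>S\<close> is \<open>\<pi>\<close>-invariant; as this holds for every threshold, so are the labels.
\<close>

section \<open>Columns and blocks\<close>

lemma finite_column: "finite (column k n l)"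
  by (simp add: column_def)

lemma finite_block: "finite (block k l)"
  by (simp add: block_def)

lemma inj_on_column_index: "l < n \<Longrightarrow> inj_on (\<lambda>i. l + i * n) B" for l n :: nat
  by (auto simp: inj_on_def)

lemma card_column: "l < n \<Longrightarrow> card (column k n l) = k"
  unfolding column_def by (simp add: card_image inj_on_column_index)

lemma card_block: "card (block k l) = k"
  by (simp add: block_def)

lemma mem_column_iff:
  assumes "l < n"
  shows "x \<in> column k n l \<longleftrightarrow> x < k * n \<and> x mod n = l"
proof
  assume "x \<in> column k n l"
  then obtain i where i: "x = l + i * n" "i < k" by (auto simp: column_def)
  have "x < (i + 1) * n" using i assms by simp
  also have "\<dots> \<le> k * n" using i by (intro mult_right_mono) auto
  finally show "x < k * n \<and> x mod n = l" using i assms by simp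
next
  assume x: "x < k * n \<and> x mod n = l"
  then have "x div n < k" by (simp add: less_mult_imp_div_less)
  moreover have "x = l + (x div n) * n" using x by (metis mod_div_mult_eq)
  ultimately show "x \<in> column k n l" by (auto simp: column_def)
qed

lemma mem_block_iff:
  assumes "l < n"
  shows "x \<in> block k l \<longleftrightarrow> x < k * n \<and> x div k = l"
proof
  assume x: "x \<in> block k l"
  then have "x < k * (l + 1)" by (simp add: block_def)
  also have "\<dots> \<le> k * n" using assms by (intro mult_left_mono) auto
  finally show "x < k * n \<and> x div k = l"
    using x by (auto simp: block_def intro!: div_nat_eqI)
next
  assume x: "x < k * n \<and> x div k = l"
  then have "k > 0" by (cases k) auto
  then have "x mod k < k" by simp
  moreover have "x = k * l + x mod k" using x by (metis mult_div_mod_eq)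
  ultimately show "x \<in> block k l" unfolding block_def
    by (metis add_less_cancel_left atLeastLessThan_iff le_add1)
qed

lemma exists_column:
  assumes "x < k * n"
  obtains l where "l < n" "x \<in> column k n l"
proof -
  have "n > 0" using assms by (cases n) auto
  then have "x mod n < n" by simp
  then show thesis using that[of "x mod n"] assms mem_column_iff by blast
qed

lemma exists_block:
  assumes "x < k * n"
  obtains l where "l < n" "x \<in> block k l"
proof -
  have "x div k < n" using assms by (simp add: less_mult_imp_div_less mult.commute)
  then show thesis using that[of "x div k"] assms mem_block_iff by blast
qed

lemma sum_over_columns:
  fixes g :: "nat \<Rightarrow> int"
  assumes "S \<subseteq> {..<k * n}"
  shows "(\<Sum>l<n. sum g (S \<inter> column k n l)) = sum g S"
proof -
  have "(\<Sum>l<n. sum g (S \<inter> column k n l)) = (\<Sum>l<n. sum g {x \<in> S. x mod n = l})"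
    using assms by (intro sum.cong refl) (auto simp: mem_column_iff)
  also have "\<dots> = sum g S"
  proof (rule sum.group)
    show "finite S" using assms finite_subset by blast
    show "(\<lambda>x. x mod n) ` S \<subseteq> {..<n}" using assms by (cases n) auto
  qed simp
  finally show ?thesis .
qed

lemma sum_over_blocks:
  fixes g :: "nat \<Rightarrow> int"
  assumes "S \<subseteq> {..<k * n}"
  shows "(\<Sum>l<n. sum g (S \<inter> block k l)) = sum g S"
proof -
  have "(\<Sum>l<n. sum g (S \<inter> block k l)) = (\<Sum>l<n. sum g {x \<in> S. x div k = l})"
    using assms by (intro sum.cong refl) (auto simp: mem_block_iff)
  also have "\<dots> = sum g S"
  proof (rule sum.group)
    show "finite S" using assms finite_subset by blast
    show "(\<lambda>x. x div k) ` S \<subseteq> {..<n}"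
      using assms by (auto simp: less_mult_imp_div_less mult.commute)
  qed simp
  finally show ?thesis .
qed

section \<open>Fixed stacks, block by block\<close>

lemma concat_blocks: "concat (map (\<lambda>l. [k * l..<k * l + k]) [0..<n]) = [0..<k * n]"
proof (induction n)
  case (Suc n)
  then show ?case using upt_add_eq_append[of 0 "k * n" k] by (simp add: add.commute)
qed simp

lemma fixed_stack_iff_blocks:
  assumes "length a = k * n"
  shows "fixed_stack k n a \<longleftrightarrow>
    (\<forall>l<n. rev (sort (map (\<lambda>i. a ! (l + i * n)) [0..<k])) = map ((!) a) [k * l..<k * l + k])"
proof -
  let ?new = "\<lambda>l. rev (sort (map (\<lambda>i. a ! (l + i * n)) [0..<k]))"
  let ?old = "\<lambda>l. map ((!) a) [k * l..<k * l + k]"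
  have "a = map ((!) a) [0..<k * n]" using assms by (metis map_nth)
  also have "\<dots> = concat (map ?old [0..<n])"
    by (simp add: concat_blocks[symmetric] map_concat comp_def)
  finally have old: "concat (map ?old [0..<n]) = a" by (rule sym)
  have "fixed_stack k n a \<longleftrightarrow> concat (map ?new [0..<n]) = concat (map ?old [0..<n])"
    by (simp only: fixed_stack_def shuffle_stack_def old)
  also have "\<dots> \<longleftrightarrow> map ?new [0..<n] = map ?old [0..<n]"
    by (intro concat_eq_concat_iff) (auto simp: set_zip)
  finally show ?thesis by (auto simp: atLeast0LessThan)
qed

lemma rev_sort_eq_iff: "rev (sort xs) = ys \<longleftrightarrow> mset xs = mset ys \<and> sorted (rev ys)"
proof
  assume "mset xs = mset ys \<and> sorted (rev ys)"
  then have "sort xs = rev ys" by (intro properties_for_sort) auto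
  then show "rev (sort xs) = ys" by simp
qed auto

lemma sorted_rev_block_iff:
  "sorted (rev (map f [k * l..<k * l + k])) \<longleftrightarrow> antimono_on (block k l) f"
proof -
  have "sorted (rev (map f [k * l..<k * l + k])) \<longleftrightarrow>
      (\<forall>i j. i \<le> j \<longrightarrow> j < k \<longrightarrow> f (k * l + j) \<le> f (k * l + i))"
    by (auto simp: sorted_rev_iff_nth_mono)
  also have "\<dots> \<longleftrightarrow> antimono_on (block k l) f"
  proof
    assume *: "\<forall>i j. i \<le> j \<longrightarrow> j < k \<longrightarrow> f (k * l + j) \<le> f (k * l + i)"
    show "antimono_on (block k l) f"
    proof (rule monotone_onI)
      fix x y assume "x \<in> block k l" "y \<in> block k l" "x \<le> y"
      then show "f x \<ge> f y"
        using *[rule_format, of "x - k * l" "y - k * l"] by (auto simp: block_def)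
    qed
  next
    assume "antimono_on (block k l) f"
    then show "\<forall>i j. i \<le> j \<longrightarrow> j < k \<longrightarrow> f (k * l + j) \<le> f (k * l + i)"
      by (auto simp: monotone_on_def block_def)
  qed
  finally show ?thesis .
qed

lemma mset_column:
  assumes "l < n"
  shows "mset (map (\<lambda>i. f (l + i * n)) [0..<k]) = image_mset f (mset_set (column k n l))"
proof -
  have "mset_set (column k n l) = image_mset (\<lambda>i. l + i * n) (mset_set {0..<k})"
    unfolding column_def using assms
    by (simp add: image_mset_mset_set inj_on_column_index atLeast0LessThan)
  then show ?thesis by (simp add: multiset.map_comp comp_def)
qed

lemma mset_block: "mset (map f [k * l..<k * l + k]) = image_mset f (mset_set (block k l))"
  by (simp add: block_def)

lemma fixed_stack_iff:
  assumes "length a = k * n"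
  shows "fixed_stack k n a \<longleftrightarrow>
    (\<forall>l<n. image_mset ((!) a) (mset_set (column k n l)) = image_mset ((!) a) (mset_set (block k l))
       \<and> antimono_on (block k l) ((!) a))"
  unfolding fixed_stack_iff_blocks[OF assms] rev_sort_eq_iff sorted_rev_block_iff
  by (intro all_cong) (simp only: mset_column mset_block)

section \<open>The permutation of a shuffling weight function\<close>

lemma weight_inj_on_block:
  assumes "shuffling_weight k n \<phi>" "l < n"
  shows "inj_on \<phi> (block k l)"
  using assms by (auto simp: shuffling_weight_def intro: strict_mono_on_imp_inj_on)

text \<open>The \<open>k\<close> subscripts of a column have the \<open>k\<close> distinct weights of the block.\<close>

lemma weight_inj_on_column:
  assumes "shuffling_weight k n \<phi>" "l < n"
  shows "inj_on \<phi> (column k n l)"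
proof (rule eq_card_imp_inj_on)
  have "card (\<phi> ` column k n l) = card (\<phi> ` block k l)"
    using assms by (simp add: shuffling_weight_def)
  also have "\<dots> = k" using weight_inj_on_block[OF assms] by (simp add: card_image card_block)
  finally show "card (\<phi> ` column k n l) = card (column k n l)" using assms by (simp add: card_column)
qed (rule finite_column)

lemma poset_perm_column:
  assumes w: "shuffling_weight k n \<phi>" and l: "l < n" and x: "x \<in> column k n l"
  shows "poset_perm k n \<phi> x \<in> block k l" "\<phi> (poset_perm k n \<phi> x) = \<phi> x"
proof -
  have xl: "x < k * n" "\<And>m. m < n \<Longrightarrow> x \<in> column k n m \<longleftrightarrow> m = l"
    using mem_column_iff l x by auto
  have "\<phi> x \<in> \<phi> ` block k l" using w l x by (auto simp: shuffling_weight_def)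
  then obtain y where y: "y \<in> block k l" "\<phi> y = \<phi> x" by auto
  have "poset_perm k n \<phi> x = (THE z. z \<in> block k l \<and> \<phi> z = \<phi> x)"
    unfolding poset_perm_def using xl l by (auto intro!: arg_cong[of _ _ The])
  also have "\<dots> = y"
    using y weight_inj_on_block[OF w l] by (intro the_equality) (auto simp: inj_on_def)
  finally show "poset_perm k n \<phi> x \<in> block k l" "\<phi> (poset_perm k n \<phi> x) = \<phi> x"
    using y by auto
qed

lemma bij_betw_poset_perm:
  assumes w: "shuffling_weight k n \<phi>" and l: "l < n"
  shows "bij_betw (poset_perm k n \<phi>) (column k n l) (block k l)"
proof -
  have inj: "inj_on (poset_perm k n \<phi>) (column k n l)"
    using poset_perm_column(2)[OF w l] weight_inj_on_column[OF w l] by (metis inj_on_def)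
  then have "card (poset_perm k n \<phi> ` column k n l) = card (block k l)"
    using l by (simp add: card_image card_column card_block)
  then have "poset_perm k n \<phi> ` column k n l = block k l"
    using poset_perm_column(1)[OF w l] by (intro card_subset_eq finite_block) auto
  then show ?thesis using inj by (simp add: bij_betw_def)
qed

text \<open>
  Following \<open>\<pi>\<close> once more avoids having to know that a subscript lies on its own orbit: every
  subscript is of the form \<open>\<pi> x\<close>, and both \<open>\<pi> x\<close> and \<open>\<pi> (\<pi> x)\<close> lie in the orbit of \<open>x\<close>.
\<close>

lemma constant_on_cycles_iff:
  assumes w: "shuffling_weight k n \<phi>"
  shows "(\<forall>C \<in> poset_cycles k n \<phi>. \<forall>x \<in> C. \<forall>y \<in> C. f x = f y) \<longleftrightarrow>
    (\<forall>x < k * n. f (poset_perm k n \<phi> x) = f x)"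
    (is "?cyc \<longleftrightarrow> ?inv")
proof
  assume cyc: ?cyc
  show ?inv
  proof (intro allI impI)
    fix y assume "y < k * n"
    then obtain l where l: "l < n" "y \<in> block k l" by (rule exists_block)
    then obtain x where x: "x \<in> column k n l" "y = poset_perm k n \<phi> x"
      using bij_betw_poset_perm[OF w l(1)] by (auto simp: bij_betw_def)
    then have "orbit (poset_perm k n \<phi>) x \<in> poset_cycles k n \<phi>"
      using l mem_column_iff by (auto simp: poset_cycles_def)
    moreover have "y \<in> orbit (poset_perm k n \<phi>) x" using x by (simp add: orbit.base)
    moreover from this have "poset_perm k n \<phi> y \<in> orbit (poset_perm k n \<phi>) x" by (rule orbit.step)
    ultimately show "f (poset_perm k n \<phi> y) = f y" using cyc by blast
  qed
next
  assume inv: ?inv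
  have closed: "poset_perm k n \<phi> x < k * n" if "x < k * n" for x
    using exists_column[OF that] poset_perm_column(1)[OF w] mem_block_iff by metis
  have "y < k * n \<and> f y = f x" if "y \<in> orbit (poset_perm k n \<phi>) x" "x < k * n" for x y
    using that by (induction rule: orbit.induct) (auto simp: inv closed)
  then show ?cyc by (auto simp: poset_cycles_def)
qed

section \<open>Invariance of the labels of a fixed stack\<close>

text \<open>
  Among the subsets of \<open>Y\<close> of a given size, an initial segment with respect to the weight has the
  least total weight, and it is the only minimizer: outside the intersection of \<open>D\<close> and \<open>T\<close>, every
  element of \<open>D\<close> weighs less than every element of \<open>T\<close>.
\<close>

lemma sum_initial_segment_less:
  fixes \<phi> :: "'b \<Rightarrow> int"
  assumes fin: "finite Y" and sub: "D \<subseteq> Y" "T \<subseteq> Y" and card: "card D = card T"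
    and init: "\<And>x y. x \<in> D \<Longrightarrow> y \<in> Y - D \<Longrightarrow> \<phi> x < \<phi> y"
    and ne: "D \<noteq> T"
  shows "sum \<phi> D < sum \<phi> T"
proof -
  have finDT: "finite D" "finite T" using fin sub finite_subset by auto
  have "card (D - T) = card (T - D)" using card finDT
    by (metis card_le_sym_Diff le_antisym order_refl)
  then obtain g where g: "bij_betw g (D - T) (T - D)"
    using finDT finite_same_card_bij by blast
  have "D - T \<noteq> {}" using ne card finDT by (metis Diff_eq_empty_iff card_subset_eq)
  then have "sum \<phi> (D - T) < (\<Sum>x\<in>D - T. \<phi> (g x))"
  proof (intro sum_strict_mono)
    fix x assume x: "x \<in> D - T"
    then have "g x \<in> T - D" using g bij_betw_apply by metis
    then show "\<phi> x < \<phi> (g x)" using x sub by (intro init) auto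
  qed (use finDT in auto)
  also have "\<dots> = sum \<phi> (T - D)" using g by (rule sum.reindex_bij_betw)
  finally have "sum \<phi> (D - T) < sum \<phi> (T - D)" .
  moreover have "sum \<phi> D = sum \<phi> (D \<inter> T) + sum \<phi> (D - T)"
    using finDT by (simp add: sum.Int_Diff)
  moreover have "sum \<phi> T = sum \<phi> (D \<inter> T) + sum \<phi> (T - D)"
    using finDT by (metis sum.Int_Diff Int_commute)
  ultimately show ?thesis by simp
qed

lemma card_eq_if_image_mset_eq:
  assumes eq: "image_mset f (mset_set X) = image_mset f (mset_set Y)"
    and "finite X" "finite Y"
  shows "card {x \<in> X. P (f x)} = card {y \<in> Y. P (f y)}"
proof -
  have "size (filter_mset P (image_mset f (mset_set Z))) = card {x \<in> Z. P (f x)}"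
    if "finite Z" for Z
    using that by (simp add: filter_mset_image_mset)
  from this[of X] this[of Y] show ?thesis using assms by simp
qed

text \<open>
  In each column the subscripts with label at least \<open>c\<close> have at least the total weight of those
  in the block. The totals over all columns and over all blocks are the same sum, so there is
  equality throughout, and uniqueness of the minimizer applies.
\<close>

lemma poset_perm_image_upper_set:
  fixes f :: "nat \<Rightarrow> 'a::linorder" and c :: 'a
  assumes w: "shuffling_weight k n \<phi>"
    and ms: "\<And>l. l < n \<Longrightarrow>
      image_mset f (mset_set (column k n l)) = image_mset f (mset_set (block k l))"
    and anti: "\<And>l. l < n \<Longrightarrow> antimono_on (block k l) f"
    and l: "l < n"
  defines "S \<equiv> {x. x < k * n \<and> c \<le> f x}"
  shows "poset_perm k n \<phi> ` (S \<inter> column k n l) = S \<inter> block k l"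
proof -
  define \<pi> where "\<pi> = poset_perm k n \<phi>"
  have S_col: "S \<inter> column k n m = {x \<in> column k n m. c \<le> f x}" if "m < n" for m
    using that by (auto simp: S_def mem_column_iff)
  have S_blk: "S \<inter> block k m = {x \<in> block k m. c \<le> f x}" if "m < n" for m
    using that by (auto simp: S_def mem_block_iff)
  have img_sum: "sum \<phi> (\<pi> ` (S \<inter> column k n m)) = sum \<phi> (S \<inter> column k n m)"
    and strict: "\<pi> ` (S \<inter> column k n m) \<noteq> S \<inter> block k m \<Longrightarrow>
      sum \<phi> (S \<inter> block k m) < sum \<phi> (S \<inter> column k n m)" if m: "m < n" for m
  proof -
    have bij: "bij_betw \<pi> (column k n m) (block k m)"
      unfolding \<pi>_def using w m by (rule bij_betw_poset_perm)
    then have inj: "inj_on \<pi> (S \<inter> column k n m)" by (auto simp: bij_betw_def inj_on_def)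
    have "\<phi> (\<pi> x) = \<phi> x" if "x \<in> S \<inter> column k n m" for x
      using poset_perm_column(2)[OF w m] that by (simp add: \<pi>_def)
    then show img_sum: "sum \<phi> (\<pi> ` (S \<inter> column k n m)) = sum \<phi> (S \<inter> column k n m)"
      by (simp add: sum.reindex[OF inj])
    assume ne: "\<pi> ` (S \<inter> column k n m) \<noteq> S \<inter> block k m"
    have "sum \<phi> (S \<inter> block k m) < sum \<phi> (\<pi> ` (S \<inter> column k n m))"
    proof (rule sum_initial_segment_less[where Y = "block k m"])
      show "\<pi> ` (S \<inter> column k n m) \<subseteq> block k m" using bij by (auto simp: bij_betw_def)
      have "card (S \<inter> column k n m) = card (S \<inter> block k m)"
        unfolding S_col[OF m] S_blk[OF m]
        using ms[OF m] finite_column finite_block by (rule card_eq_if_image_mset_eq)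
      then show "card (S \<inter> block k m) = card (\<pi> ` (S \<inter> column k n m))"
        using inj by (simp add: card_image)
      fix x y assume x: "x \<in> S \<inter> block k m" and y: "y \<in> block k m - S \<inter> block k m"
      then have "f y < f x" using m by (auto simp: S_blk)
      then have "\<not> y \<le> x" using monotone_onD[OF anti[OF m], of y x] x y by auto
      then show "\<phi> x < \<phi> y"
        using w m x y by (auto simp: shuffling_weight_def strict_mono_on_def)
    qed (use ne finite_block in auto)
    then show "sum \<phi> (S \<inter> block k m) < sum \<phi> (S \<inter> column k n m)" using img_sum by simp
  qed
  have sub: "S \<subseteq> {..<k * n}" by (auto simp: S_def)
  have "sum \<phi> (S \<inter> block k l) = sum \<phi> (S \<inter> column k n l)"
  proof (rule sum_mono_inv[where I = "{..<n}"])
    show "(\<Sum>m<n. sum \<phi> (S \<inter> block k m)) = (\<Sum>m<n. sum \<phi> (S \<inter> column k n m))"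
      using sum_over_columns[OF sub] sum_over_blocks[OF sub] by simp
    show "sum \<phi> (S \<inter> block k m) \<le> sum \<phi> (S \<inter> column k n m)" if "m \<in> {..<n}" for m
      using img_sum[of m] strict[of m] that by fastforce
  qed (use l in auto)
  then show ?thesis using strict[OF l] unfolding \<pi>_def by fastforce
qed

lemma poset_perm_invariant:
  fixes f :: "nat \<Rightarrow> 'a::linorder"
  assumes w: "shuffling_weight k n \<phi>"
    and ms: "\<And>l. l < n \<Longrightarrow>
      image_mset f (mset_set (column k n l)) = image_mset f (mset_set (block k l))"
    and anti: "\<And>l. l < n \<Longrightarrow> antimono_on (block k l) f"
    and x: "x < k * n"
  shows "f (poset_perm k n \<phi> x) = f x"
proof -
  define \<pi> where "\<pi> = poset_perm k n \<phi>"
  from x obtain l where l: "l < n" and xl: "x \<in> column k n l" by (rule exists_column)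
  have bij: "bij_betw \<pi> (column k n l) (block k l)"
    unfolding \<pi>_def using w l by (rule bij_betw_poset_perm)
  then have px: "\<pi> x \<in> block k l" "\<pi> x < k * n"
    using xl l by (auto simp: bij_betw_def mem_block_iff)
  have "c \<le> f (\<pi> x) \<longleftrightarrow> c \<le> f x" for c
  proof -
    define S where "S = {x. x < k * n \<and> c \<le> f x}"
    have img: "\<pi> ` (S \<inter> column k n l) = S \<inter> block k l"
      unfolding \<pi>_def S_def using w ms anti l by (rule poset_perm_image_upper_set)
    have "\<pi> x \<in> S \<longleftrightarrow> \<pi> x \<in> \<pi> ` (S \<inter> column k n l)" using img px by auto
    also have "\<dots> \<longleftrightarrow> x \<in> S" using bij xl by (auto simp: bij_betw_def inj_on_def)
    finally show ?thesis using x px by (simp add: S_def)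
  qed
  from this[of "f x"] this[of "f (\<pi> x)"] show ?thesis unfolding \<pi>_def by (auto intro: antisym)
qed

section \<open>Monotonicity along the edges\<close>

text \<open>
  Along \<open>\<pi>\<close>, comparing weights in a column turns into comparing weights in a block, which is
  comparing subscripts.
\<close>

lemma edge_monotone_iff:
  fixes f :: "nat \<Rightarrow> 'a::linorder"
  assumes w: "shuffling_weight k n \<phi>"
    and inv: "\<forall>x < k * n. f (poset_perm k n \<phi> x) = f x"
  shows "(\<forall>x y. poset_edge k n x y \<and> \<phi> x < \<phi> y \<longrightarrow> f x \<ge> f y) \<longleftrightarrow>
    (\<forall>l<n. antimono_on (block k l) f)"
    (is "?edge \<longleftrightarrow> ?anti")
proof
  assume edge: ?edge
  show ?anti
  proof (intro allI impI monotone_onI)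
    fix l y z assume l: "l < n" and yz: "y \<in> block k l" "z \<in> block k l" "y \<le> z"
    have "y \<in> poset_perm k n \<phi> ` column k n l" "z \<in> poset_perm k n \<phi> ` column k n l"
      using yz bij_betw_imp_surj_on[OF bij_betw_poset_perm[OF w l]] by simp_all
    then obtain u v where uv: "u \<in> column k n l" "v \<in> column k n l"
      "y = poset_perm k n \<phi> u" "z = poset_perm k n \<phi> v"
      by (elim imageE)
    then have "u < k * n" "v < k * n" using l by (simp_all add: mem_column_iff)
    then have fuv: "f y = f u" "f z = f v" using inv uv(3,4) by simp_all
    show "f y \<ge> f z"
    proof (cases "y = z")
      case False
      then have "\<phi> y < \<phi> z"
        using yz w l by (simp add: shuffling_weight_def strict_mono_on_def)
      then have "\<phi> u < \<phi> v" using uv poset_perm_column(2)[OF w l] by simp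
      moreover from this have "poset_edge k n u v" using uv l by (auto simp: poset_edge_def)
      ultimately show ?thesis using edge fuv by simp
    qed simp
  qed
next
  assume anti: ?anti
  show ?edge
  proof (intro allI impI)
    fix u v assume uv: "poset_edge k n u v \<and> \<phi> u < \<phi> v"
    then obtain l where l: "l < n" "u \<in> column k n l" "v \<in> column k n l"
      by (auto simp: poset_edge_def)
    let ?y = "poset_perm k n \<phi> u" and ?z = "poset_perm k n \<phi> v"
    have yz: "?y \<in> block k l" "?z \<in> block k l" "\<phi> ?y < \<phi> ?z"
      using poset_perm_column[OF w l(1)] l uv by auto
    have "?y \<le> ?z"
    proof (rule ccontr)
      assume "\<not> ?y \<le> ?z"
      then have "\<phi> ?z < \<phi> ?y"
        using yz w l by (auto simp: shuffling_weight_def strict_mono_on_def)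
      then show False using yz by simp
    qed
    then have "f ?y \<ge> f ?z" using anti yz l by (meson monotone_onD)
    moreover have "u < k * n" "v < k * n" using l by (simp_all add: mem_column_iff)
    ultimately show "f u \<ge> f v" using inv by simp
  qed
qed

lemma image_mset_column_eq_block:
  assumes w: "shuffling_weight k n \<phi>"
    and inv: "\<forall>x < k * n. f (poset_perm k n \<phi> x) = f x"
    and l: "l < n"
  shows "image_mset f (mset_set (column k n l)) = image_mset f (mset_set (block k l))"
proof -
  have bij: "bij_betw (poset_perm k n \<phi>) (column k n l) (block k l)"
    using w l by (rule bij_betw_poset_perm)
  then have "image_mset f (mset_set (block k l)) =
      image_mset f (image_mset (poset_perm k n \<phi>) (mset_set (column k n l)))"
    by (simp add: image_mset_mset_set bij_betw_def)
  also have "\<dots> = image_mset (\<lambda>x. f (poset_perm k n \<phi> x)) (mset_set (column k n l))"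
    by (simp add: multiset.map_comp comp_def)
  also have "\<dots> = image_mset f (mset_set (column k n l))"
    using inv l by (intro image_mset_cong) (auto simp: mem_column_iff finite_column)
  finally show ?thesis by simp
qed

section \<open>The characterization\<close>

theorem mainTheorem3:
  fixes k n :: nat
    and \<phi> :: "nat \<Rightarrow> int"
    and A :: "'a::linorder set"
    and a :: "'a list"
  assumes "k \<ge> 2" and "n \<ge> 1"
    and "shuffling_weight k n \<phi>"
    and "finite A" and "set a \<subseteq> A" and "length a = k * n"
  shows "fixed_stack k n a \<longleftrightarrow>
    (\<forall>x y. poset_edge k n x y \<and> \<phi> x < \<phi> y \<longrightarrow> a ! x \<ge> a ! y) \<and>
    (\<forall>C \<in> poset_cycles k n \<phi>. \<forall>x \<in> C. \<forall>y \<in> C. a ! x = a ! y)"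
proof -
  note w = assms(3)
  show ?thesis
    unfolding fixed_stack_iff[OF assms(6)] constant_on_cycles_iff[OF w]
  proof (intro iffI conjI allI impI)
    assume fixed: "\<forall>l<n. image_mset ((!) a) (mset_set (column k n l)) =
        image_mset ((!) a) (mset_set (block k l)) \<and> antimono_on (block k l) ((!) a)"
    then show inv: "a ! poset_perm k n \<phi> x = a ! x" if "x < k * n" for x
      using poset_perm_invariant[OF w _ _ that, of "(!) a"] by simp
    show "a ! x \<ge> a ! y" if "poset_edge k n x y \<and> \<phi> x < \<phi> y" for x y
      using edge_monotone_iff[OF w, of "(!) a"] inv fixed that by simp
  next
    fix l assume l: "l < n"
    assume *: "(\<forall>x y. poset_edge k n x y \<and> \<phi> x < \<phi> y \<longrightarrow> a ! x \<ge> a ! y) \<and>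
      (\<forall>x<k * n. a ! poset_perm k n \<phi> x = a ! x)"
    then show "image_mset ((!) a) (mset_set (column k n l)) =
        image_mset ((!) a) (mset_set (block k l))"
      using image_mset_column_eq_block[OF w _ l, of "(!) a"] by simp
    show "antimono_on (block k l) ((!) a)"
      using edge_monotone_iff[OF w, of "(!) a"] * l by simp
  qed
qed

end
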